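(* Let $\phi$ be a weak isometry of $\mathcal{C}_n$. Then $\phi$ is one of the following: \begin{itemize} \item an isometry; \item an $\{n\}$-isometry; \item an even isometry; \item an $\{\frac{n}{2},n\}$-isometry (with $n$ even); \item an $\{\frac{n+1}{2}\}$-isometry (with $n$ odd); \item an $\{\frac{n-1}{2},\frac{n+1}{2},n\}$-isometry (with $n$ odd). \end{itemize}
   Context: Let $n\ge 1$ and let $\mathcal{C}_n=\{0,1\}^n$ be the Boolean cube equipped with the Hamming distance $d$ (the number of coordinates in which two words differ). For a set $P\subset\{1,2,\ldots,n\}$, a $P$-isometry of $\mathcal{C}_n$ is a bijection $\phi:\mathcal{C}_n\to\mathcal{C}_n$ preserving every distance $p\in P$, i.e. $d(\phi(x),\phi(y))=p$ whenever $d(x,y)=p$, for every $p\in P$. A weak isometry is a $P$-isometry for some non-empty $P\subset\{1,\ldots,n\}$. An isometry is a bijection preserving all distances. An even isometry is a $P$-isometry with $P$ the set of all even numbers in $\{1,2,\ldots,n\}$. *)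

theory Defs
  imports Main "HOL-Library.FuncSet"
begin

definition cube :: "nat \<Rightarrow> (nat \<Rightarrow> nat) set" where
  "cube n = {1..n} \<rightarrow>\<^sub>E {0, 1}"

definition hamming :: "nat \<Rightarrow> (nat \<Rightarrow> nat) \<Rightarrow> (nat \<Rightarrow> nat) \<Rightarrow> nat" where
  "hamming n x y = card {i \<in> {1..n}. x i \<noteq> y i}"

text \<open>Maps of the cube are total functions on \<^typ>\<open>nat \<Rightarrow> nat\<close>; only their restriction to
  \<^term>\<open>cube n\<close> matters.\<close>

definition P_isometry :: "nat \<Rightarrow> nat set \<Rightarrow> ((nat \<Rightarrow> nat) \<Rightarrow> (nat \<Rightarrow> nat)) \<Rightarrow> bool" where
  "P_isometry n P \<phi> \<longleftrightarrow>
     P \<subseteq> {1..n} \<and> bij_betw \<phi> (cube n) (cube n) \<and>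
     (\<forall>p\<in>P. \<forall>x\<in>cube n. \<forall>y\<in>cube n. hamming n x y = p \<longrightarrow> hamming n (\<phi> x) (\<phi> y) = p)"

definition weak_isometry :: "nat \<Rightarrow> ((nat \<Rightarrow> nat) \<Rightarrow> (nat \<Rightarrow> nat)) \<Rightarrow> bool" where
  "weak_isometry n \<phi> \<longleftrightarrow> (\<exists>P. P \<noteq> {} \<and> P \<subseteq> {1..n} \<and> P_isometry n P \<phi>)"

definition cube_isometry :: "nat \<Rightarrow> ((nat \<Rightarrow> nat) \<Rightarrow> (nat \<Rightarrow> nat)) \<Rightarrow> bool" where
  "cube_isometry n \<phi> \<longleftrightarrow>
     bij_betw \<phi> (cube n) (cube n) \<and>
     (\<forall>x\<in>cube n. \<forall>y\<in>cube n. hamming n (\<phi> x) (\<phi> y) = hamming n x y)"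

definition even_isometry :: "nat \<Rightarrow> ((nat \<Rightarrow> nat) \<Rightarrow> (nat \<Rightarrow> nat)) \<Rightarrow> bool" where
  "even_isometry n \<phi> \<longleftrightarrow> P_isometry n {p \<in> {1..n}. even p} \<phi>"

end

theory Submission
  imports Defs Complex_Main
begin

text \<open>
  A weak isometry preserves at least one distance \<open>p\<close>, so it is enough to study an automorphism \<open>\<phi>\<close>
  of the graph that joins words at distance \<open>p\<close>. Such a map preserves the number of common
  neighbours of two words. Words at odd distance have none. Words at distance \<open>2k\<close> have
  \<open>(2k choose k) * (n - 2k choose p - k)\<close> of them, since a common neighbour differs from the first
  word in half of the \<open>2k\<close> places where the two words differ and in \<open>p - k\<close> of the other places.

  Put \<open>q = min p (n - p)\<close> and suppose \<open>1 \<le> q\<close> and \<open>2q < n\<close>. Among \<open>k = 1, ..., q\<close> this count is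
  largest at \<open>k = 1\<close>, by a comparison with three terms of a Vandermonde sum
  (\<open>central_product_less\<close>). It takes that value a second time only if \<open>n = 2q + 1\<close>, at \<open>k = q\<close>.
  Therefore distance 2 goes to distance 2, or possibly to \<open>n - 1\<close> when \<open>p\<close> is next to half the
  dimension (\<open>image_of_distance_two\<close>). If distance 2 is preserved, then so is the path metric of the
  graph of distance 2, and \<open>\<phi>\<close> is an even isometry. Three kinds of \<open>p < n\<close> remain.

  If \<open>n = 2p\<close>, two distinct words have the same neighbours exactly when they are antipodal, so
  antipodal pairs are preserved (\<open>half_distance\<close>).

  If \<open>n + 1 = 2p\<close>, the preserved distance \<open>p\<close> is the one in the conclusion, as it is for \<open>p = n\<close>.

  If \<open>n = 2p + 1\<close>, distance 2 goes to 2 or \<open>n - 1\<close>. Steps of these two lengths change the folded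
  distance \<open>min d (n + 1 - d)\<close> of words at an even distance \<open>d\<close> by at most 2, so \<open>\<phi>\<close> takes words at
  distance \<open>2m\<close> to words at folded distance at most \<open>2m\<close> (\<open>folded_distance_chain\<close>). Moreover \<open>\<phi>\<close>
  takes the sphere of radius \<open>p\<close> around \<open>y\<close> to the sphere around its image, and the least folded
  distance from \<open>x\<close> to this sphere tells apart the cases that matter. For even \<open>p\<close> it is \<open>p - 2\<close> when
  \<open>d(x, y) = 2\<close> and \<open>p\<close> when \<open>d(x, y) = n - 1\<close>, so distance 2 is preserved after all
  (\<open>below_half_even\<close>). For odd \<open>p\<close> it is \<open>p + 1\<close> when \<open>y\<close> is the antipode of \<open>x\<close>, and at most \<open>p - 1\<close>
  for every other \<open>y\<close> at odd distance, so antipodes are preserved. Words at distance \<open>p + 1\<close> are at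
  distance \<open>p\<close> from each other's antipodes, so this distance is preserved too (\<open>below_half_odd\<close>).
\<close>

section \<open>Geometry of the cube\<close>

lemma card_Int_plus_Diff: "finite A \<Longrightarrow> card A = card (A \<inter> B) + card (A - B)"
  by (metis card_Un_disjoint Int_Diff_Un Int_Diff_disjoint finite_Diff finite_Int)

definition diffs :: "nat \<Rightarrow> (nat \<Rightarrow> nat) \<Rightarrow> (nat \<Rightarrow> nat) \<Rightarrow> nat set" where
  "diffs n x y = {i \<in> {1..n}. x i \<noteq> y i}"

definition flip :: "(nat \<Rightarrow> nat) \<Rightarrow> nat set \<Rightarrow> nat \<Rightarrow> nat" where
  "flip x S = (\<lambda>i. if i \<in> S then 1 - x i else x i)"

lemma hamming_diffs: "hamming n x y = card (diffs n x y)"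
  by (simp add: hamming_def diffs_def)

lemma finite_diffs [simp]: "finite (diffs n x y)"
  by (simp add: diffs_def)

lemma diffs_subset: "diffs n x y \<subseteq> {1..n}"
  by (auto simp: diffs_def)

lemma diffs_commute: "diffs n x y = diffs n y x"
  by (auto simp: diffs_def)

lemma hamming_commute: "hamming n x y = hamming n y x"
  by (simp add: hamming_diffs diffs_commute)

lemma hamming_le: "hamming n x y \<le> n"
proof -
  have "card (diffs n x y) \<le> card {1..n}"
    by (rule card_mono) (simp, rule diffs_subset)
  then show ?thesis by (simp add: hamming_diffs)
qed

lemma finite_cube [simp]: "finite (cube n)"
  unfolding cube_def by (rule finite_PiE) auto

lemma cube_coord: "x \<in> cube n \<Longrightarrow> i \<in> {1..n} \<Longrightarrow> x i = 0 \<or> x i = 1"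
  unfolding cube_def by (drule (1) PiE_mem) simp

lemma cube_eqI:
  assumes "x \<in> cube n" "y \<in> cube n" "\<And>i. i \<in> {1..n} \<Longrightarrow> x i = y i"
  shows "x = y"
  using PiE_ext[of x "{1..n}" "\<lambda>_. {0, 1}" y] assms unfolding cube_def by blast

lemma hamming_eq_0_iff:
  assumes "x \<in> cube n" "y \<in> cube n"
  shows "hamming n x y = 0 \<longleftrightarrow> x = y"
  using cube_eqI[OF assms] by (auto simp: hamming_def)

lemma flip_in_cube:
  assumes "x \<in> cube n" "S \<subseteq> {1..n}"
  shows "flip x S \<in> cube n"
  using assms unfolding cube_def flip_def by (auto simp: PiE_iff extensional_def)

lemma diffs_sym_diff:
  assumes "x \<in> cube n" "y \<in> cube n" "z \<in> cube n"
  shows "diffs n y z = (diffs n x y - diffs n x z) \<union> (diffs n x z - diffs n x y)"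
proof -
  have "y i \<noteq> z i \<longleftrightarrow> (x i \<noteq> y i) \<noteq> (x i \<noteq> z i)" if "i \<in> {1..n}" for i
    using assms[THEN cube_coord, OF that] by auto
  then show ?thesis by (auto simp: diffs_def)
qed

lemma diffs_flip:
  assumes "x \<in> cube n" "S \<subseteq> {1..n}"
  shows "diffs n x (flip x S) = S"
proof -
  have "x i \<noteq> 1 - x i" if "i \<in> {1..n}" for i
    using cube_coord[OF assms(1) that] by auto
  then show ?thesis using assms(2) by (auto simp: diffs_def flip_def)
qed

lemma bij_betw_diffs:
  assumes x: "x \<in> cube n"
  shows "bij_betw (diffs n x) (cube n) (Pow {1..n})"
proof (rule bij_betwI[where g = "flip x"])
  show "flip x (diffs n x z) = z" if z: "z \<in> cube n" for z
  proof (rule cube_eqI[OF flip_in_cube[OF x diffs_subset] z])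
    show "flip x (diffs n x z) i = z i" if "i \<in> {1..n}" for i
      using cube_coord[OF x that] cube_coord[OF z that] that by (auto simp: flip_def diffs_def)
  qed
  show "diffs n x (flip x S) = S" if "S \<in> Pow {1..n}" for S
    using diffs_flip[OF x] that by simp
  show "diffs n x \<in> cube n \<rightarrow> Pow {1..n}" using diffs_subset by blast
  show "flip x \<in> Pow {1..n} \<rightarrow> cube n" using flip_in_cube[OF x] by blast
qed

text \<open>The three difference sets of a triangle cover every coordinate either twice or not at all.
  Hence half the perimeter is the size \<open>u\<close> of their union. The triangle inequality, the evenness
  of the perimeter and its bound \<open>2 * n\<close> can all be read off from \<open>u\<close>.\<close>

lemma hamming_triangle:
  assumes "x \<in> cube n" "y \<in> cube n" "z \<in> cube n"
  obtains u where "hamming n x y + hamming n x z + hamming n y z = 2 * u" "u \<le> n"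
    "hamming n x y \<le> u" "hamming n x z \<le> u" "hamming n y z \<le> u"
proof -
  let ?A = "diffs n x y" and ?B = "diffs n x z"
  have C: "diffs n y z = (?A - ?B) \<union> (?B - ?A)"
    by (rule diffs_sym_diff[OF assms])
  have "card (diffs n y z) = card (?A - ?B) + card (?B - ?A)"
    unfolding C by (rule card_Un_disjoint) auto
  moreover have "card ?A = card (?A - ?B) + card (?A \<inter> ?B)"
    using card_Int_plus_Diff[of ?A ?B] by simp
  moreover have "card ?B = card (?B - ?A) + card (?A \<inter> ?B)"
    using card_Int_plus_Diff[of ?B ?A] by (simp add: Int_commute)
  moreover have "card (?A \<union> ?B) + card (?A \<inter> ?B) = card ?A + card ?B"
    using card_Un_Int[of ?A ?B] by simp
  moreover have "card (?A \<union> ?B) \<le> n"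
    using card_mono[of "{1..n}" "?A \<union> ?B"] diffs_subset by simp
  ultimately show thesis
    by (intro that[of "card (?A \<union> ?B)"]) (simp_all add: hamming_diffs)
qed

lemma hamming_parity:
  assumes "x \<in> cube n" "y \<in> cube n" "z \<in> cube n"
  shows "even (hamming n x z) \<longleftrightarrow> (even (hamming n x y) \<longleftrightarrow> even (hamming n y z))"
proof -
  obtain u where "hamming n x y + hamming n x z + hamming n y z = 2 * u"
    by (rule hamming_triangle[OF assms])
  then have "even (hamming n x y + hamming n x z + hamming n y z)" by simp
  then show ?thesis by (simp add: even_add) blast
qed

text \<open>The triangle inequality between a point and a sphere is attained: flip in the centre \<open>y\<close> a set
  of \<open>p\<close> places that is comparable with the difference set of \<open>x\<close> and \<open>y\<close>. With \<open>p = 2\<close> this also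
  supplies the next vertex on a geodesic of steps of length 2.\<close>

lemma nearest_on_sphere:
  assumes x: "x \<in> cube n" and y: "y \<in> cube n" and "p \<le> n"
  obtains z where "z \<in> cube n" "hamming n y z = p"
    "int (hamming n x z) = \<bar>int (hamming n x y) - int p\<bar>"
proof -
  let ?D = "diffs n y x"
  have "\<exists>S\<subseteq>{1..n}. card S = p \<and> (S \<subseteq> ?D \<or> ?D \<subseteq> S)"
  proof (cases "p \<le> card ?D")
    case True
    then obtain S where "S \<subseteq> ?D" "card S = p"
      by (metis obtain_subset_with_card_n)
    then show ?thesis using diffs_subset by blast
  next
    case False
    then show ?thesis
      using exists_subset_between[of ?D p "{1..n}"] diffs_subset \<open>p \<le> n\<close>
      by (metis card_atLeastAtMost diff_Suc_1 finite_atLeastAtMost nat_le_linear)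
  qed
  then obtain S where S: "S \<subseteq> {1..n}" "card S = p" "S \<subseteq> ?D \<or> ?D \<subseteq> S" by blast
  let ?z = "flip y S"
  have z: "?z \<in> cube n" by (rule flip_in_cube[OF y S(1)])
  have D: "diffs n y ?z = S" by (rule diffs_flip[OF y S(1)])
  have X: "diffs n x ?z = (?D - S) \<union> (S - ?D)"
    using diffs_sym_diff[OF y x z] D by simp
  have fS: "finite S" using S(1) finite_subset by blast
  have "int (card (diffs n x ?z)) = \<bar>int (card ?D) - int p\<bar>"
    using S(3)
  proof
    assume "S \<subseteq> ?D"
    then show ?thesis
      using card_Diff_subset[OF fS, of ?D] card_mono[of ?D S] S(2)
      by (simp add: X Diff_eq_empty_iff[THEN iffD2] of_nat_diff)
  next
    assume "?D \<subseteq> S"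
    then show ?thesis
      using card_Diff_subset[of ?D S] card_mono[OF fS, of ?D] S(2)
      by (simp add: X Diff_eq_empty_iff[THEN iffD2] of_nat_diff)
  qed
  then show thesis
    using that[OF z] D S(2) by (simp add: hamming_diffs diffs_commute)
qed

lemma antipode_exists:
  assumes "x \<in> cube n"
  obtains x' where "x' \<in> cube n" "hamming n x x' = n"
proof -
  obtain z where "z \<in> cube n" "hamming n x z = n"
    by (rule nearest_on_sphere[OF assms assms order_refl])
  then show thesis by (rule that)
qed

lemma hamming_antipode:
  assumes "x \<in> cube n" "x' \<in> cube n" "z \<in> cube n" "hamming n x x' = n"
  shows "hamming n x z + hamming n x' z = n"
proof -
  obtain u where "hamming n x x' + hamming n x z + hamming n x' z = 2 * u" "u \<le> n"
    "hamming n x x' \<le> u"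
    by (rule hamming_triangle[OF assms(1-3)])
  then show ?thesis using assms(4) by linarith
qed

section \<open>Bijections that preserve one distance\<close>

lemma P_isometry_in_cube: "P_isometry n P \<phi> \<Longrightarrow> x \<in> cube n \<Longrightarrow> \<phi> x \<in> cube n"
  unfolding P_isometry_def using bij_betwE by blast

lemma P_isometry_bij: "P_isometry n P \<phi> \<Longrightarrow> bij_betw \<phi> (cube n) (cube n)"
  unfolding P_isometry_def by simp

lemma P_isometry_eq_iff:
  "P_isometry n P \<phi> \<Longrightarrow> x \<in> cube n \<Longrightarrow> y \<in> cube n \<Longrightarrow> \<phi> x = \<phi> y \<longleftrightarrow> x = y"
  using inj_on_eq_iff[OF bij_betw_imp_inj_on[OF P_isometry_bij]] .

lemma P_isometry_preserves:
  "P_isometry n P \<phi> \<Longrightarrow> x \<in> cube n \<Longrightarrow> y \<in> cube n \<Longrightarrow> hamming n x y \<in> P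
    \<Longrightarrow> hamming n (\<phi> x) (\<phi> y) = hamming n x y"
  unfolding P_isometry_def by auto

text \<open>The pairs at distance \<open>p\<close> form a finite set that the bijection sends injectively into itself,
  hence onto itself. So no other pair can be sent to distance \<open>p\<close>.\<close>

lemma P_isometry_reflects:
  assumes \<phi>: "P_isometry n P \<phi>" and xy: "x \<in> cube n" "y \<in> cube n"
    and p: "hamming n (\<phi> x) (\<phi> y) \<in> P"
  shows "hamming n x y = hamming n (\<phi> x) (\<phi> y)"
proof -
  define p where "p = hamming n (\<phi> x) (\<phi> y)"
  define E where "E = {e \<in> cube n \<times> cube n. hamming n (fst e) (snd e) = p}"
  have "finite E" unfolding E_def by simp
  moreover have "map_prod \<phi> \<phi> ` E \<subseteq> E"
    using P_isometry_preserves[OF \<phi>] P_isometry_in_cube[OF \<phi>] assms(4)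
    unfolding E_def p_def by auto
  moreover have "inj_on (map_prod \<phi> \<phi>) E"
    using P_isometry_eq_iff[OF \<phi>] unfolding E_def inj_on_def by auto
  ultimately have "map_prod \<phi> \<phi> ` E = E" by (rule endo_inj_surj)
  moreover have "(\<phi> x, \<phi> y) \<in> E"
    using P_isometry_in_cube[OF \<phi>] xy unfolding E_def p_def by simp
  ultimately obtain x' y' where "(x', y') \<in> E" "\<phi> x = \<phi> x'" "\<phi> y = \<phi> y'" by force
  then show ?thesis using P_isometry_eq_iff[OF \<phi>] xy unfolding E_def p_def by auto
qed

lemma P_isometry_inverse:
  assumes \<phi>: "P_isometry n P \<phi>"
  obtains \<psi> where "P_isometry n P \<psi>" "\<And>x. x \<in> cube n \<Longrightarrow> \<psi> (\<phi> x) = x"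
    "\<And>x. x \<in> cube n \<Longrightarrow> \<phi> (\<psi> x) = x"
proof -
  let ?\<psi> = "inv_into (cube n) \<phi>"
  have bij: "bij_betw \<phi> (cube n) (cube n)" by (rule P_isometry_bij[OF \<phi>])
  have bij': "bij_betw ?\<psi> (cube n) (cube n)" by (rule bij_betw_inv_into[OF bij])
  have right: "\<phi> (?\<psi> x) = x" if "x \<in> cube n" for x
    using bij_betw_inv_into_right[OF bij that] .
  have "hamming n (?\<psi> x) (?\<psi> y) = hamming n x y"
    if "x \<in> cube n" "y \<in> cube n" "hamming n x y \<in> P" for x y
    using P_isometry_reflects[OF \<phi>, of "?\<psi> x" "?\<psi> y"] that right bij_betwE[OF bij'] by auto
  then have "P_isometry n P ?\<psi>"
    using \<phi> bij' unfolding P_isometry_def by auto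
  then show thesis
    using that right bij_betw_inv_into_left[OF bij] by blast
qed

definition common_neighbours :: "nat \<Rightarrow> nat \<Rightarrow> (nat \<Rightarrow> nat) \<Rightarrow> (nat \<Rightarrow> nat) \<Rightarrow> (nat \<Rightarrow> nat) set" where
  "common_neighbours n p x y = {z \<in> cube n. hamming n x z = p \<and> hamming n y z = p}"

lemma card_common_neighbours_image:
  assumes \<phi>: "P_isometry n {p} \<phi>" and xy: "x \<in> cube n" "y \<in> cube n"
  shows "card (common_neighbours n p (\<phi> x) (\<phi> y)) = card (common_neighbours n p x y)"
proof -
  obtain \<psi> where \<psi>: "P_isometry n {p} \<psi>" "\<And>x. x \<in> cube n \<Longrightarrow> \<psi> (\<phi> x) = x"
    "\<And>x. x \<in> cube n \<Longrightarrow> \<phi> (\<psi> x) = x"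
    by (rule P_isometry_inverse[OF \<phi>]) blast
  have "bij_betw \<phi> (common_neighbours n p x y) (common_neighbours n p (\<phi> x) (\<phi> y))"
  proof (rule bij_betwI[where g = \<psi>])
    show "\<phi> \<in> common_neighbours n p x y \<rightarrow> common_neighbours n p (\<phi> x) (\<phi> y)"
      using P_isometry_preserves[OF \<phi>] P_isometry_in_cube[OF \<phi>] xy by (auto simp: common_neighbours_def)
    show "\<psi> \<in> common_neighbours n p (\<phi> x) (\<phi> y) \<rightarrow> common_neighbours n p x y"
    proof
      fix w assume w: "w \<in> common_neighbours n p (\<phi> x) (\<phi> y)"
      then have c: "w \<in> cube n" and d: "hamming n (\<phi> x) w = p" "hamming n (\<phi> y) w = p"
        by (simp_all add: common_neighbours_def)
      have "hamming n (\<psi> (\<phi> u)) (\<psi> w) = p" if "u \<in> cube n" "hamming n (\<phi> u) w = p" for u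
        using P_isometry_preserves[OF \<psi>(1) P_isometry_in_cube[OF \<phi> that(1)] c] that(2) by simp
      then show "\<psi> w \<in> common_neighbours n p x y"
        using xy \<psi>(2) d P_isometry_in_cube[OF \<psi>(1) c] by (simp add: common_neighbours_def)
    qed
  qed (use \<psi> in \<open>auto simp: common_neighbours_def\<close>)
  then show ?thesis by (simp add: bij_betw_same_card)
qed

section \<open>Counting common neighbours\<close>

lemma common_neighbours_empty_if_odd:
  assumes "x \<in> cube n" "y \<in> cube n" "odd (hamming n x y)"
  shows "common_neighbours n p x y = {}"
proof -
  have False if z: "z \<in> cube n" "hamming n x z = p" "hamming n y z = p" for z
    using hamming_parity[OF assms(1) z(1) assms(2)] assms(3) z by (simp add: hamming_commute)
  then show ?thesis by (auto simp: common_neighbours_def)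
qed

lemma common_neighbours_empty_if_far:
  assumes "x \<in> cube n" "y \<in> cube n" "hamming n x y > 2 * min p (n - p)" "p \<le> n"
  shows "common_neighbours n p x y = {}"
proof -
  have False if z: "z \<in> cube n" "hamming n x z = p" "hamming n y z = p" for z
  proof -
    obtain u where "hamming n x y + hamming n x z + hamming n y z = 2 * u" "u \<le> n"
      "hamming n x y \<le> u"
      by (rule hamming_triangle[OF assms(1,2) z(1)])
    then show False using z assms by linarith
  qed
  then show ?thesis by (auto simp: common_neighbours_def)
qed

text \<open>The difference set of \<open>x\<close> and a common neighbour splits into a part inside and a part outside
  the difference set of \<open>x\<close> and \<open>y\<close>. Equal distances to \<open>x\<close> and \<open>y\<close> force the inner part to be
  exactly half; nothing else restricts the two parts except their sizes.\<close>

lemma card_common_neighbours: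
  assumes x: "x \<in> cube n" and y: "y \<in> cube n" and d: "hamming n x y = 2 * k" and "k \<le> p"
  shows "card (common_neighbours n p x y) = ((2 * k) choose k) * ((n - 2 * k) choose (p - k))"
proof -
  let ?D = "diffs n x y"
  let ?X = "{A. A \<subseteq> ?D \<and> card A = k}" and ?Y = "{B. B \<subseteq> {1..n} - ?D \<and> card B = p - k}"
  have cD: "card ?D = 2 * k" using d by (simp add: hamming_diffs)
  have mem: "hamming n x z = p \<and> hamming n y z = p
      \<longleftrightarrow> card (diffs n x z \<inter> ?D) = k \<and> card (diffs n x z - ?D) = p - k"
    if z: "z \<in> cube n" for z
  proof -
    let ?Z = "diffs n x z"
    have "card ?Z = card (?Z \<inter> ?D) + card (?Z - ?D)"
      by (rule card_Int_plus_Diff) simp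
    moreover have "card ?D = card (?Z \<inter> ?D) + card (?D - ?Z)"
      using card_Int_plus_Diff[of ?D ?Z] by (simp add: Int_commute)
    moreover have "card (diffs n y z) = card (?D - ?Z) + card (?Z - ?D)"
      unfolding diffs_sym_diff[OF x y z] by (rule card_Un_disjoint) auto
    ultimately show ?thesis using cD \<open>k \<le> p\<close> unfolding hamming_diffs by linarith
  qed
  have "bij_betw (\<lambda>z. (diffs n x z \<inter> ?D, diffs n x z - ?D)) (common_neighbours n p x y) (?X \<times> ?Y)"
  proof (rule bij_betwI[where g = "\<lambda>(A, B). flip x (A \<union> B)"])
    show "(\<lambda>z. (diffs n x z \<inter> ?D, diffs n x z - ?D)) \<in> common_neighbours n p x y \<rightarrow> ?X \<times> ?Y"
    proof
      fix z assume z: "z \<in> common_neighbours n p x y"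
      then have "card (diffs n x z \<inter> ?D) = k" "card (diffs n x z - ?D) = p - k"
        using mem[of z] by (simp_all add: common_neighbours_def)
      moreover have "diffs n x z - ?D \<subseteq> {1..n} - ?D" using diffs_subset by blast
      ultimately show "(diffs n x z \<inter> ?D, diffs n x z - ?D) \<in> ?X \<times> ?Y" by simp
    qed
    show "(\<lambda>(A, B). flip x (A \<union> B)) \<in> ?X \<times> ?Y \<rightarrow> common_neighbours n p x y"
    proof clarify
      fix A B assume A: "A \<subseteq> ?D" "k = card A" and B: "B \<subseteq> {1..n} - ?D" "card B = p - card A"
      have S: "A \<union> B \<subseteq> {1..n}" using A(1) B(1) diffs_subset[of n x y] by blast
      have "(A \<union> B) \<inter> ?D = A" "(A \<union> B) - ?D = B" using A(1) B(1) by auto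
      then show "flip x (A \<union> B) \<in> common_neighbours n p x y"
        using mem[OF flip_in_cube[OF x S]] A(2) B(2) flip_in_cube[OF x S]
        by (simp add: common_neighbours_def diffs_flip[OF x S])
    qed
    show "(case (diffs n x z \<inter> ?D, diffs n x z - ?D) of (A, B) \<Rightarrow> flip x (A \<union> B)) = z"
      if "z \<in> common_neighbours n p x y" for z
    proof -
      have z: "z \<in> cube n" using that by (simp add: common_neighbours_def)
      have "diffs n x (flip x (diffs n x z)) = diffs n x z"
        by (rule diffs_flip[OF x diffs_subset])
      then have "flip x (diffs n x z) = z"
        by (rule inj_onD[OF bij_betw_imp_inj_on[OF bij_betw_diffs[OF x]] _
              flip_in_cube[OF x diffs_subset] z])
      then show ?thesis by (simp add: Int_Diff_Un)
    qed
    show "(diffs n x (case e of (A, B) \<Rightarrow> flip x (A \<union> B)) \<inter> ?D,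
        diffs n x (case e of (A, B) \<Rightarrow> flip x (A \<union> B)) - ?D) = e" if "e \<in> ?X \<times> ?Y" for e
    proof -
      obtain A B where e: "e = (A, B)" by (cases e)
      have AB: "A \<subseteq> ?D" "B \<subseteq> {1..n} - ?D" using that e by auto
      then have S: "A \<union> B \<subseteq> {1..n}" using diffs_subset[of n x y] by blast
      have "(A \<union> B) \<inter> ?D = A" "(A \<union> B) - ?D = B" using AB by blast+
      then show ?thesis by (simp add: e diffs_flip[OF x S])
    qed
  qed
  then have "card (common_neighbours n p x y) = card (?X \<times> ?Y)" by (rule bij_betw_same_card)
  also have "\<dots> = card ?X * card ?Y" by (rule card_cartesian_product)
  also have "card ?X = (2 * k) choose k" using n_subsets[of ?D k] cD by simp
  also have "card ?Y = (n - 2 * k) choose (p - k)"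
    using n_subsets[of "{1..n} - ?D" "p - k"] cD card_Diff_subset[OF finite_diffs diffs_subset, of n x y]
    by simp
  finally show ?thesis .
qed

text \<open>Complementing the outer part makes the count symmetric in \<open>p\<close> and \<open>n - p\<close>, so that both halves
  of the range of \<open>p\<close> are covered by the same binomial estimate.\<close>

lemma card_common_neighbours_min:
  assumes x: "x \<in> cube n" and y: "y \<in> cube n" and d: "hamming n x y = 2 * k"
    and k: "k \<le> min p (n - p)" and p: "p \<le> n"
  shows "card (common_neighbours n p x y) = ((2 * k) choose k) * ((n - 2 * k) choose (min p (n - p) - k))"
proof -
  have "k \<le> p" using k by simp
  have "(n - 2 * k) choose (p - k) = (n - 2 * k) choose (n - p - k)"
  proof -
    have "n - 2 * k - (p - k) = n - p - k" "p - k \<le> n - 2 * k" using k p by linarith+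
    then show ?thesis using binomial_symmetric[of "p - k" "n - 2 * k"] by simp
  qed
  then show ?thesis
    using card_common_neighbours[OF x y d, of p] \<open>k \<le> p\<close> by (simp add: min_def)
qed

text \<open>Three consecutive terms of the Vandermonde sum. The conditional removes the last one when
  \<open>j = 0\<close>, where the truncated \<open>j - 1\<close> would stand for a negative lower index.\<close>

lemma central_terms_le_vandermonde:
  fixes a j M N :: nat
  shows "(M choose a) * (N choose Suc j) + (M choose Suc a) * (N choose j)
    + (M choose Suc (Suc a)) * (if j = 0 then 0 else N choose (j - 1)) \<le> (M + N) choose (a + j + 1)"
proof -
  let ?f = "\<lambda>i. (M choose i) * (N choose (a + j + 1 - i))"
  have "sum ?f (if j = 0 then {a, Suc a} else {a, Suc a, Suc (Suc a)}) \<le> sum ?f {..a + j + 1}"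
    by (rule sum_mono2) auto
  also have "\<dots> = (M + N) choose (a + j + 1)" by (rule vandermonde)
  finally show ?thesis by (auto split: if_splits simp: numeral_2_eq_2)
qed

lemma central_binomial_step:
  "(2 * a + 4) choose (a + 2) = 2 * (((2 * a + 2) choose a) + ((2 * a + 2) choose (a + 1)))"
proof -
  have "(2 * a + 3) choose (a + 2) = (2 * a + 3) choose (a + 1)"
    using binomial_symmetric[of "a + 2" "2 * a + 3"] by simp
  moreover have "(2 * a + 4) choose (a + 2) = ((2 * a + 3) choose (a + 2)) + ((2 * a + 3) choose (a + 1))"
    using binomial_Suc_Suc[of "2 * a + 3" "a + 1"] by (simp add: eval_nat_numeral)
  moreover have "(2 * a + 3) choose (a + 1) = ((2 * a + 2) choose a) + ((2 * a + 2) choose (a + 1))"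
    using binomial_Suc_Suc[of "2 * a + 2" a] by (simp add: eval_nat_numeral)
  ultimately show ?thesis by simp
qed

text \<open>With \<open>k = a + 2\<close>, \<open>j = q - k\<close> and \<open>N = n - 2 * k\<close> the two sides count common neighbours at
  distance \<open>2 * k\<close> and at distance 2. Half of the left side is a sum of two products. One is a
  Vandermonde term of the right side, and the other is at most its neighbouring term because
  \<open>j\<close> lies below the middle of the row \<open>N\<close>. Equality needs \<open>N = 2 * j + 1\<close> and a vanishing third term,
  that is \<open>j = 0\<close>.\<close>

lemma central_product_less:
  fixes a j N :: nat
  assumes N: "2 * j + 1 \<le> N" and strict: "2 * j + 1 < N \<or> 0 < j"
  shows "((2 * a + 4) choose (a + 2)) * (N choose j) < 2 * ((2 * a + 2 + N) choose (a + j + 1))"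
proof -
  let ?M = "2 * a + 2"
  have pos: "0 < ?M choose a" "0 < ?M choose Suc (Suc a)" by simp_all
  have "N choose j \<le> N choose Suc j"
  proof (cases "2 * j + 1 = N")
    case True
    then have "N - j = Suc j" "j \<le> N" by simp_all
    then show ?thesis using binomial_symmetric[of j N] by simp
  next
    case False
    then have "j < N div 2" using N by linarith
    then show ?thesis using binomial_less_binomial_Suc[of j N] by simp
  qed
  then have le: "(?M choose a) * (N choose j) \<le> (?M choose a) * (N choose Suc j)" by simp
  have "(?M choose a) * (N choose j) + (?M choose Suc a) * (N choose j) < (?M + N) choose (a + j + 1)"
  proof (cases "0 < j")
    case True
    then have "0 < (?M choose Suc (Suc a)) * (if j = 0 then 0 else N choose (j - 1))"
      using pos N by simp
    then show ?thesis using central_terms_le_vandermonde[of ?M a N j] le by linarith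
  next
    case False
    then have "N choose j < N choose Suc j"
      using strict binomial_less_binomial_Suc[of j N] by simp
    then have "(?M choose a) * (N choose j) < (?M choose a) * (N choose Suc j)" using pos by simp
    then show ?thesis using central_terms_le_vandermonde[of ?M a N j] by linarith
  qed
  then show ?thesis unfolding central_binomial_step by (simp add: algebra_simps)
qed

text \<open>The exceptional alternative is real as far as counting goes: for \<open>n = 2 * q + 1\<close> the distances
  2 and \<open>n - 1\<close> give \<open>2 * (2 * q - 1 choose q - 1)\<close> and \<open>2 * q choose q\<close> common neighbours, which is the
  same number.\<close>

lemma image_of_distance_two:
  assumes \<phi>: "P_isometry n {p} \<phi>" and p: "1 \<le> p" "p < n" "2 * p \<noteq> n"
    and x: "x \<in> cube n" and y: "y \<in> cube n" and d: "hamming n x y = 2"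
  shows "hamming n (\<phi> x) (\<phi> y) = 2
    \<or> (n = 2 * min p (n - p) + 1 \<and> hamming n (\<phi> x) (\<phi> y) = n - 1)"
proof -
  define q where "q = min p (n - p)"
  have q: "1 \<le> q" "2 * q + 1 \<le> n" "p \<le> n" using p unfolding q_def by linarith+
  have \<phi>x: "\<phi> x \<in> cube n" and \<phi>y: "\<phi> y \<in> cube n"
    using P_isometry_in_cube[OF \<phi>] x y by auto
  let ?d = "hamming n (\<phi> x) (\<phi> y)"
  have "card (common_neighbours n p x y) = 2 * ((n - 2) choose (q - 1))"
    using card_common_neighbours_min[OF x y, of 1 p] d q by (simp add: q_def)
  then have c: "card (common_neighbours n p (\<phi> x) (\<phi> y)) = 2 * ((n - 2) choose (q - 1))"
    using card_common_neighbours_image[OF \<phi> x y] by simp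
  moreover have "0 < (n - 2) choose (q - 1)" using q by simp
  ultimately have ne: "common_neighbours n p (\<phi> x) (\<phi> y) \<noteq> {}" by auto
  have "even ?d" using common_neighbours_empty_if_odd[OF \<phi>x \<phi>y, of p] ne by blast
  then obtain k where k: "?d = 2 * k" by blast
  have "k \<le> q"
    using common_neighbours_empty_if_far[OF \<phi>x \<phi>y, of p] ne q(3) k unfolding q_def
    by (metis mult_less_cancel1 not_le zero_less_numeral)
  have "x \<noteq> y" using d hamming_eq_0_iff[OF x y] by auto
  then have "k \<noteq> 0"
    using P_isometry_eq_iff[OF \<phi> x y] hamming_eq_0_iff[OF \<phi>x \<phi>y] k by auto
  show ?thesis
  proof (cases "k = 1")
    case True
    then show ?thesis using k by simp
  next
    case False
    define a j N where "a = k - 2" and "j = q - k" and "N = n - 2 * k"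
    have eqs: "2 * a + 4 = 2 * k" "a + 2 = k" "2 * a + 2 + N = n - 2" "a + j + 1 = q - 1"
      using False \<open>k \<noteq> 0\<close> \<open>k \<le> q\<close> q unfolding a_def j_def N_def by linarith+
    have "card (common_neighbours n p (\<phi> x) (\<phi> y)) = ((2 * k) choose k) * (N choose j)"
      using card_common_neighbours_min[OF \<phi>x \<phi>y k _ q(3)] \<open>k \<le> q\<close> unfolding q_def j_def N_def by simp
    then have "\<not> ((2 * a + 4) choose (a + 2)) * (N choose j) < 2 * ((2 * a + 2 + N) choose (a + j + 1))"
      unfolding eqs using c by simp
    moreover have "2 * j + 1 \<le> N"
      using \<open>k \<le> q\<close> q unfolding j_def N_def by linarith
    ultimately have "\<not> (2 * j + 1 < N \<or> 0 < j)" using central_product_less by blast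
    then have "q = k" "n = 2 * k + 1"
      using \<open>k \<le> q\<close> \<open>2 * j + 1 \<le> N\<close> q unfolding j_def N_def by linarith+
    then show ?thesis using k unfolding q_def by simp
  qed
qed

section \<open>From one distance to many\<close>

text \<open>A pair at distance \<open>2 * m\<close> is joined by \<open>m\<close> steps of length 2, and so is its image. The same bound
  for the inverse map will turn the inequality into an equality.\<close>

lemma distance_two_chain:
  assumes \<phi>: "P_isometry n {2} \<phi>" and x: "x \<in> cube n"
  shows "z \<in> cube n \<Longrightarrow> hamming n x z = 2 * m
    \<Longrightarrow> even (hamming n (\<phi> x) (\<phi> z)) \<and> hamming n (\<phi> x) (\<phi> z) \<le> 2 * m"
proof (induction m arbitrary: z)
  case 0
  then have "x = z" using hamming_eq_0_iff[OF x] by simp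
  then show ?case by (simp add: hamming_def)
next
  case (Suc m)
  have f: "\<And>x. x \<in> cube n \<Longrightarrow> \<phi> x \<in> cube n" by (rule P_isometry_in_cube[OF \<phi>])
  have "2 \<le> n" using hamming_le[of n x z] Suc.prems by simp
  obtain w where w: "w \<in> cube n" "hamming n z w = 2"
    "int (hamming n x w) = \<bar>int (hamming n x z) - int 2\<bar>"
    by (rule nearest_on_sphere[OF x Suc.prems(1) \<open>2 \<le> n\<close>])
  then have "hamming n x w = 2 * m" using Suc.prems by simp
  then have "even (hamming n (\<phi> x) (\<phi> w)) \<and> hamming n (\<phi> x) (\<phi> w) \<le> 2 * m"
    by (rule Suc.IH[OF w(1)])
  moreover have "hamming n (\<phi> z) (\<phi> w) = 2"
    using P_isometry_preserves[OF \<phi> Suc.prems(1) w(1)] w(2) by simp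
  moreover obtain u where
    "hamming n (\<phi> x) (\<phi> w) + hamming n (\<phi> x) (\<phi> z) + hamming n (\<phi> w) (\<phi> z) = 2 * u"
    "u \<le> n" "hamming n (\<phi> x) (\<phi> w) \<le> u" "hamming n (\<phi> x) (\<phi> z) \<le> u"
    by (rule hamming_triangle[OF f[OF x] f[OF w(1)] f[OF Suc.prems(1)]])
  ultimately show ?case
    using hamming_parity[OF f[OF x] f[OF w(1)] f[OF Suc.prems(1)]]
    by (simp add: hamming_commute[of n "\<phi> w"])
qed

lemma even_isometry_if_distance_two:
  assumes \<phi>: "P_isometry n {2} \<phi>"
  shows "even_isometry n \<phi>"
proof -
  have chain: "even (hamming n (f x) (f y)) \<and> hamming n (f x) (f y) \<le> hamming n x y"
    if f: "P_isometry n {2} f" and xy: "x \<in> cube n" "y \<in> cube n" and e: "even (hamming n x y)"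
    for f x y
  proof -
    obtain m where m: "hamming n x y = 2 * m" using e by blast
    show ?thesis unfolding m by (rule distance_two_chain[OF f xy m])
  qed
  obtain \<psi> where \<psi>: "P_isometry n {2} \<psi>" "\<And>x. x \<in> cube n \<Longrightarrow> \<psi> (\<phi> x) = x"
    by (rule P_isometry_inverse[OF \<phi>]) blast
  have "hamming n (\<phi> x) (\<phi> y) = hamming n x y"
    if xy: "x \<in> cube n" "y \<in> cube n" and e: "even (hamming n x y)" for x y
    using chain[OF \<phi> xy e] chain[OF \<psi>(1) P_isometry_in_cube[OF \<phi> xy(1)] P_isometry_in_cube[OF \<phi> xy(2)]]
      \<psi>(2) xy by simp
  then show ?thesis
    using P_isometry_bij[OF \<phi>] unfolding even_isometry_def P_isometry_def by auto
qed

section \<open>Distances next to half the dimension\<close>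

text \<open>Words \<open>x\<close>, \<open>y\<close> at a distance \<open>d\<close> strictly between 0 and \<open>n = 2 * p\<close> do not have the same
  neighbours, because some neighbour of \<open>x\<close> is at distance \<open>\<bar>d - p\<bar> < p\<close> from
  \<open>y\<close>. Antipodal words do, and having the same neighbours is invariant under \<open>\<phi>\<close>.\<close>

lemma half_distance:
  assumes \<phi>: "P_isometry n {p} \<phi>" and n: "n = 2 * p" and "1 \<le> p"
  shows "P_isometry n {p, n} \<phi>"
proof -
  have "p \<le> n" using n by simp
  obtain \<psi> where \<psi>: "P_isometry n {p} \<psi>" "\<And>x. x \<in> cube n \<Longrightarrow> \<psi> (\<phi> x) = x"
    "\<And>x. x \<in> cube n \<Longrightarrow> \<phi> (\<psi> x) = x"
    by (rule P_isometry_inverse[OF \<phi>]) blast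
  have "hamming n (\<phi> x) (\<phi> y) = n"
    if xy: "x \<in> cube n" "y \<in> cube n" and d: "hamming n x y = n" for x y
  proof (rule ccontr)
    assume ne: "hamming n (\<phi> x) (\<phi> y) \<noteq> n"
    have fxy: "\<phi> x \<in> cube n" "\<phi> y \<in> cube n" using P_isometry_in_cube[OF \<phi>] xy by auto
    have "x \<noteq> y" using d n \<open>1 \<le> p\<close> hamming_eq_0_iff[OF xy] by auto
    then have "hamming n (\<phi> x) (\<phi> y) \<noteq> 0"
      using hamming_eq_0_iff[OF fxy] P_isometry_eq_iff[OF \<phi> xy] by simp
    moreover obtain z where z: "z \<in> cube n" "hamming n (\<phi> x) z = p"
      "int (hamming n (\<phi> y) z) = \<bar>int (hamming n (\<phi> y) (\<phi> x)) - int p\<bar>"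
      by (rule nearest_on_sphere[OF fxy(2,1) \<open>p \<le> n\<close>])
    ultimately have far: "hamming n (\<phi> y) z \<noteq> p"
      using ne hamming_le[of n "\<phi> x" "\<phi> y"] n hamming_commute[of n "\<phi> x" "\<phi> y"] by linarith
    have \<psi>z: "\<psi> z \<in> cube n" by (rule P_isometry_in_cube[OF \<psi>(1) z(1)])
    have "hamming n x (\<psi> z) = p"
      using P_isometry_preserves[OF \<psi>(1) fxy(1) z(1)] z(2) \<psi>(2) xy by simp
    then have "hamming n y (\<psi> z) = p"
      using hamming_antipode[OF xy \<psi>z d] n by simp
    then have "hamming n (\<phi> y) z = p"
      using P_isometry_preserves[OF \<phi> xy(2) \<psi>z] \<psi>(3) z(1) by simp
    then show False using far by simp
  qed
  then show ?thesis using \<phi> unfolding P_isometry_def by auto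
qed

text \<open>A step changes the folded distance \<open>min d (n + 1 - d)\<close> by at most 2, whether it has length 2
  or \<open>n - 1\<close>. So the image of a geodesic of \<open>m\<close> steps of length 2 stays within folded distance
  \<open>2 * m\<close>.\<close>

lemma folded_distance_chain:
  assumes \<phi>: "P_isometry n {p} \<phi>" and n: "n = 2 * p + 1" and "1 \<le> p" and x: "x \<in> cube n"
  shows "z \<in> cube n \<Longrightarrow> hamming n x z = 2 * m \<Longrightarrow> even (hamming n (\<phi> x) (\<phi> z))
    \<and> (hamming n (\<phi> x) (\<phi> z) \<le> 2 * m \<or> n + 1 \<le> hamming n (\<phi> x) (\<phi> z) + 2 * m)"
proof (induction m arbitrary: z)
  case 0
  then have "x = z" using hamming_eq_0_iff[OF x] by simp
  then show ?case by (simp add: hamming_def)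
next
  case (Suc m)
  have f: "\<And>x. x \<in> cube n \<Longrightarrow> \<phi> x \<in> cube n" by (rule P_isometry_in_cube[OF \<phi>])
  have "2 \<le> n" using hamming_le[of n x z] Suc.prems by simp
  obtain w where w: "w \<in> cube n" "hamming n z w = 2"
    "int (hamming n x w) = \<bar>int (hamming n x z) - int 2\<bar>"
    by (rule nearest_on_sphere[OF x Suc.prems(1) \<open>2 \<le> n\<close>])
  then have "hamming n x w = 2 * m" using Suc.prems by simp
  then have IH: "even (hamming n (\<phi> x) (\<phi> w))"
    "hamming n (\<phi> x) (\<phi> w) \<le> 2 * m \<or> n + 1 \<le> hamming n (\<phi> x) (\<phi> w) + 2 * m"
    using Suc.IH[OF w(1)] by auto
  have step: "hamming n (\<phi> w) (\<phi> z) = 2 \<or> hamming n (\<phi> w) (\<phi> z) = 2 * p"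
    using image_of_distance_two[OF \<phi> _ _ _ Suc.prems(1) w(1,2)] n \<open>1 \<le> p\<close>
    by (auto simp: hamming_commute)
  obtain u where u:
    "hamming n (\<phi> x) (\<phi> w) + hamming n (\<phi> x) (\<phi> z) + hamming n (\<phi> w) (\<phi> z) = 2 * u"
    "u \<le> n" "hamming n (\<phi> x) (\<phi> w) \<le> u" "hamming n (\<phi> x) (\<phi> z) \<le> u" "hamming n (\<phi> w) (\<phi> z) \<le> u"
    by (rule hamming_triangle[OF f[OF x] f[OF w(1)] f[OF Suc.prems(1)]])
  have "even (hamming n (\<phi> w) (\<phi> z))" using step by auto
  then have "even (hamming n (\<phi> x) (\<phi> z))" using hamming_parity[OF f[OF x] f[OF w(1)] f[OF Suc.prems(1)]] IH(1) by simp
  moreover have "hamming n (\<phi> x) (\<phi> z) \<le> 2 * Suc m \<or> n + 1 \<le> hamming n (\<phi> x) (\<phi> z) + 2 * Suc m"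
  proof (rule ccontr)
    assume "\<not> ?thesis"
    then have "2 * m + 2 < hamming n (\<phi> x) (\<phi> z)" "hamming n (\<phi> x) (\<phi> z) + 2 * m + 2 < n + 1"
      by simp_all
    with IH(2) u n show False
      using step by (elim disjE) linarith+
  qed
  ultimately show ?case by blast
qed

text \<open>If \<open>x\<close>, \<open>y\<close> were at distance 2 and their images at distance \<open>n - 1 = 2 * p\<close>, some neighbour
  \<open>z\<close> of \<open>y\<close> would be at distance \<open>p - 2\<close> from \<open>x\<close>, hence its image at folded distance at most \<open>p - 2\<close>
  from the image of \<open>x\<close>. But the triangle inequalities allow the image of \<open>z\<close> only the distances \<open>p\<close>
  to \<open>p + 2\<close>, whose folded distances are at least \<open>p\<close>.\<close>

lemma below_half_even:
  assumes \<phi>: "P_isometry n {p} \<phi>" and n: "n = 2 * p + 1" and p: "1 \<le> p" "even p"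
  shows "even_isometry n \<phi>"
proof -
  have "2 \<le> p" using p by presburger
  have f: "\<And>x. x \<in> cube n \<Longrightarrow> \<phi> x \<in> cube n" by (rule P_isometry_in_cube[OF \<phi>])
  have two: "hamming n (\<phi> x) (\<phi> y) = 2 \<or> hamming n (\<phi> x) (\<phi> y) = n - 1"
    if "x \<in> cube n" "y \<in> cube n" "hamming n x y = 2" for x y
    using image_of_distance_two[OF \<phi> _ _ _ that] p n by auto
  have "hamming n (\<phi> x) (\<phi> y) = 2"
    if xy: "x \<in> cube n" "y \<in> cube n" and d: "hamming n x y = 2" for x y
  proof (rule ccontr)
    assume "hamming n (\<phi> x) (\<phi> y) \<noteq> 2"
    then have far: "hamming n (\<phi> x) (\<phi> y) = 2 * p" using two[OF xy d] n by simp
    obtain z where z: "z \<in> cube n" "hamming n y z = p"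
      "int (hamming n x z) = \<bar>int (hamming n x y) - int p\<bar>"
      using nearest_on_sphere[OF xy, of p] n by auto
    obtain m where m: "p = 2 * m" using p by blast
    have "hamming n x z = 2 * (m - 1)" using z(3) d m \<open>2 \<le> p\<close> by linarith
    then have "hamming n (\<phi> x) (\<phi> z) \<le> 2 * (m - 1) \<or> n + 1 \<le> hamming n (\<phi> x) (\<phi> z) + 2 * (m - 1)"
      using folded_distance_chain[OF \<phi> n p(1) xy(1) z(1)] by blast
    moreover have "hamming n (\<phi> y) (\<phi> z) = p"
      using P_isometry_preserves[OF \<phi> xy(2) z(1)] z(2) by simp
    moreover obtain u where
      "hamming n (\<phi> x) (\<phi> y) + hamming n (\<phi> x) (\<phi> z) + hamming n (\<phi> y) (\<phi> z) = 2 * u"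
      "u \<le> n" "hamming n (\<phi> x) (\<phi> y) \<le> u"
      by (rule hamming_triangle[OF f[OF xy(1)] f[OF xy(2)] f[OF z(1)]])
    ultimately show False using far n m \<open>2 \<le> p\<close> by linarith
  qed
  then have "P_isometry n {2} \<phi>"
    using P_isometry_bij[OF \<phi>] n \<open>2 \<le> p\<close> unfolding P_isometry_def by simp
  then show ?thesis by (rule even_isometry_if_distance_two)
qed

text \<open>For antipodal \<open>x\<close>, \<open>y\<close> all neighbours of \<open>y\<close> are at distance \<open>p + 1\<close>, the largest possible folded
  distance, from \<open>x\<close>. If the images were not antipodal, the image of \<open>y\<close> would have a neighbour
  at distance at most \<open>p - 1\<close> from the image of \<open>x\<close>, and the inverse map would bring it back to
  folded distance at most \<open>p - 1\<close> from \<open>x\<close>.\<close>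

lemma below_half_odd:
  assumes \<phi>: "P_isometry n {p} \<phi>" and n: "n = 2 * p + 1" and p: "1 \<le> p" "odd p"
  shows "P_isometry n {p, p + 1, n} \<phi>"
proof -
  have "p \<le> n" using n by simp
  obtain \<psi> where \<psi>: "P_isometry n {p} \<psi>" "\<And>x. x \<in> cube n \<Longrightarrow> \<psi> (\<phi> x) = x"
    by (rule P_isometry_inverse[OF \<phi>]) blast
  have g: "\<And>x. x \<in> cube n \<Longrightarrow> \<psi> x \<in> cube n" by (rule P_isometry_in_cube[OF \<psi>(1)])
  note chain = folded_distance_chain[OF \<psi>(1) n p(1)]
  have antipode: "hamming n (\<phi> x) (\<phi> y) = n"
    if xy: "x \<in> cube n" "y \<in> cube n" and d: "hamming n x y = n" for x y
  proof (rule ccontr)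
    assume ne: "hamming n (\<phi> x) (\<phi> y) \<noteq> n"
    have fxy: "\<phi> x \<in> cube n" "\<phi> y \<in> cube n" using P_isometry_in_cube[OF \<phi>] xy by auto
    have o: "odd (hamming n (\<phi> x) (\<phi> y))"
    proof
      assume "even (hamming n (\<phi> x) (\<phi> y))"
      then obtain m where "hamming n (\<phi> x) (\<phi> y) = 2 * m" by blast
      then show False using chain[OF fxy] \<psi>(2) xy d n by simp
    qed
    obtain z where z: "z \<in> cube n" "hamming n (\<phi> y) z = p"
      "int (hamming n (\<phi> x) z) = \<bar>int (hamming n (\<phi> x) (\<phi> y)) - int p\<bar>"
      by (rule nearest_on_sphere[OF fxy \<open>p \<le> n\<close>])
    have "even (hamming n (\<phi> x) z)" using hamming_parity[OF fxy z(1)] z(2) o p(2) by simp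
    then obtain m where m: "hamming n (\<phi> x) z = 2 * m" by blast
    obtain b where "hamming n (\<phi> x) (\<phi> y) = 2 * b + 1" using o by (rule oddE)
    moreover from this have "b < p" using ne n hamming_le[of n "\<phi> x" "\<phi> y"] by simp
    ultimately have small: "2 * m + 1 \<le> p" using z(3) m by linarith
    have "hamming n y (\<psi> z) = p"
      using P_isometry_preserves[OF \<psi>(1) fxy(2) z(1)] z(2) \<psi>(2) xy by simp
    then have "hamming n x (\<psi> z) = p + 1"
      using hamming_antipode[OF xy g[OF z(1)] d] n by simp
    then show False using chain[OF fxy(1) z(1) m] \<psi>(2) xy small n by simp
  qed
  have "hamming n (\<phi> x) (\<phi> y) = p + 1"
    if xy: "x \<in> cube n" "y \<in> cube n" and d: "hamming n x y = p + 1" for x y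
  proof -
    obtain x' where x': "x' \<in> cube n" "hamming n x x' = n" by (rule antipode_exists[OF xy(1)])
    have "hamming n x' y = p" using hamming_antipode[OF xy(1) x'(1) xy(2) x'(2)] d n by simp
    then have "hamming n (\<phi> x') (\<phi> y) = p" using P_isometry_preserves[OF \<phi> x'(1) xy(2)] by simp
    moreover have "hamming n (\<phi> x) (\<phi> x') = n" by (rule antipode[OF xy(1) x'])
    ultimately show ?thesis
      using hamming_antipode[of "\<phi> x" n "\<phi> x'" "\<phi> y"] P_isometry_in_cube[OF \<phi>] xy x'(1) n by simp
  qed
  then show ?thesis using \<phi> antipode n unfolding P_isometry_def by auto
qed

section \<open>The classification\<close>

theorem mainTheorem1:
  fixes n :: nat and \<phi> :: "(nat \<Rightarrow> nat) \<Rightarrow> (nat \<Rightarrow> nat)"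
  assumes "n \<ge> 1"
    and "weak_isometry n \<phi>"
  shows "cube_isometry n \<phi>
    \<or> P_isometry n {n} \<phi>
    \<or> even_isometry n \<phi>
    \<or> (even n \<and> P_isometry n {n div 2, n} \<phi>)
    \<or> (odd n \<and> P_isometry n {(n + 1) div 2} \<phi>)
    \<or> (odd n \<and> P_isometry n {(n - 1) div 2, (n + 1) div 2, n} \<phi>)"
proof -
  obtain p where \<phi>: "P_isometry n {p} \<phi>" and p: "1 \<le> p" "p \<le> n"
  proof -
    obtain P p where "P_isometry n P \<phi>" "p \<in> P"
      using assms(2) unfolding weak_isometry_def by blast
    then have "P_isometry n {p} \<phi>" "1 \<le> p" "p \<le> n" unfolding P_isometry_def by auto
    then show thesis by (rule that)
  qed
  consider "p = n" | "n = 2 * p" | "n + 1 = 2 * p" | "n = 2 * p + 1" "even p"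
    | "n = 2 * p + 1" "odd p" | "p < n" "2 * p \<noteq> n" "n \<noteq> 2 * min p (n - p) + 1"
    using p by linarith
  then show ?thesis
  proof cases
    case 1
    then show ?thesis using \<phi> by simp
  next
    case 2
    then show ?thesis using half_distance[OF \<phi> 2 p(1)] by simp
  next
    case 3
    then have "odd n" "(n + 1) div 2 = p" by presburger+
    then show ?thesis using \<phi> by simp
  next
    case 4
    then show ?thesis using below_half_even[OF \<phi> 4(1) p(1) 4(2)] by simp
  next
    case 5
    then show ?thesis using below_half_odd[OF \<phi> 5(1) p(1) 5(2)] by simp
  next
    case 6
    have "2 \<le> n" using 6(1) p(1) by linarith
    then have "P_isometry n {2} \<phi>"
      using image_of_distance_two[OF \<phi> p(1) 6(1,2)] 6(3) P_isometry_bij[OF \<phi>]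
      unfolding P_isometry_def by auto
    then have ev: "even_isometry n \<phi>" by (rule even_isometry_if_distance_two)
    then show ?thesis by simp
  qed
qed

end
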